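(* Suppose $G$ is a group of order $n$, where $n-1=n_1n_2$ for positive integers $n_1$ and $n_2$. Suppose there exists an $(s,t)$-$\lambda$-fold near-factorization of $G$ with $\min\{s,t\}>1$, $s=\lambda_1n_1$, $t=\lambda_2n_2$ and $\lambda=\lambda_1\lambda_2$. Then $$\lambda\le\begin{cases}\frac{n+1}{4}&\text{if }n_1\text{ and }n_2\text{ are both even},\\[2pt] \frac{(n_1+1)(n-n_2+1)}{4n_1}&\text{if }n_1\text{ is odd and }n_2\text{ is even},\\[2pt] \frac{(n_2+1)(n-n_1+1)}{4n_2}&\text{if }n_1\text{ is even and }n_2\text{ is odd},\\[2pt] \min\left\{\frac{(n_1+1)(n-n_2+1)}{4n_1},\frac{(n_2+1)(n-n_1+1)}{4n_2}\right\}&\text{if }n_1\text{ and }n_2\text{ are both odd}.\end{cases}$$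
   Context: For subsets $S,T$ of a finite group $G$ with identity $e$, and a positive integer $\lambda$, $(S,T)$ is a $\lambda$-fold near-factorization of $G$ if every non-identity element $g\in G$ can be written as $g=xy$ with $x\in S$, $y\in T$ in exactly $\lambda$ ways, and $xy\neq e$ for all $x\in S$, $y\in T$. It is an $(s,t)$-$\lambda$-fold near-factorization if moreover $|S|=s$ and $|T|=t$. *)

theory Defs
  imports Complex_Main "HOL-Algebra.Coset"
begin

definition near_factorization ::
    "('a, 'b) monoid_scheme \<Rightarrow> nat \<Rightarrow> 'a set \<Rightarrow> 'a set \<Rightarrow> bool" where
  "near_factorization G lam S T \<longleftrightarrow>
     lam > 0 \<and> S \<subseteq> carrier G \<and> T \<subseteq> carrier G \<and>
     (\<forall>g \<in> carrier G - {\<one>\<^bsub>G\<^esub>}.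
        card {(x, y). x \<in> S \<and> y \<in> T \<and> x \<otimes>\<^bsub>G\<^esub> y = g} = lam) \<and>
     (\<forall>x \<in> S. \<forall>y \<in> T. x \<otimes>\<^bsub>G\<^esub> y \<noteq> \<one>\<^bsub>G\<^esub>)"

definition st_near_factorization ::
    "('a, 'b) monoid_scheme \<Rightarrow> nat \<Rightarrow> nat \<Rightarrow> nat \<Rightarrow> 'a set \<Rightarrow> 'a set \<Rightarrow> bool" where
  "st_near_factorization G s t lam S T \<longleftrightarrow>
     near_factorization G lam S T \<and> card S = s \<and> card T = t"

end

theory Submission
  imports Defs
begin

text \<open>
  No product \<open>x y\<close> with \<open>x \<in> S\<close>, \<open>y \<in> T\<close> is the identity, so \<open>T\<close> avoids the inverses
  of \<open>S\<close>, whence \<open>s + t \<le> n\<close>, that is \<open>\<lambda>\<^sub>1 n\<^sub>1 + \<lambda>\<^sub>2 n\<^sub>2 \<le> n\<^sub>1 n\<^sub>2 + 1\<close>. All bounds maximise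
  \<open>\<lambda>\<^sub>1 \<lambda>\<^sub>2\<close> under this constraint: AM-GM in general, and, when \<open>n\<^sub>1\<close> is odd, the maximum over
  integers \<open>\<lambda>\<^sub>2\<close> of the concave quadratic obtained by eliminating \<open>\<lambda>\<^sub>1\<close>, attained next to
  the half-integer \<open>n\<^sub>1 / 2\<close>.
\<close>

lemma st_near_factorization_add_le_order:
  assumes "group G" and "finite (carrier G)" and "st_near_factorization G s t lam S T"
  shows "s + t \<le> order G"
proof -
  interpret group G by fact
  have S: "S \<subseteq> carrier G" and T: "T \<subseteq> carrier G" and card: "card S = s" "card T = t"
    and prod: "\<And>x y. x \<in> S \<Longrightarrow> y \<in> T \<Longrightarrow> x \<otimes>\<^bsub>G\<^esub> y \<noteq> \<one>\<^bsub>G\<^esub>"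
    using assms(3) by (auto simp: st_near_factorization_def near_factorization_def)
  let ?I = "(\<lambda>x. inv\<^bsub>G\<^esub> x) ` S"
  have "card ?I = s"
    using S card by (metis card_image inj_on_subset inv_inj)
  moreover have "?I \<inter> T = {}"
    using S prod by fastforce
  moreover have "?I \<union> T \<subseteq> carrier G"
    using S T by auto
  ultimately show ?thesis
    using card(2) assms(2) unfolding order_def
    by (metis card_Un_disjoint card_mono finite_Un finite_subset)
qed

text \<open>With \<open>N = p * q\<close>, AM-GM gives
  \<open>4 * (a * b) * N \<le> (N + 1)\<^sup>2\<close>, so \<open>4 * (a * b)\<close> is at most
  \<open>N + 2 + 1 / N\<close>; integrality removes the last term because
  \<open>1 < N\<close>.\<close>

lemma four_mult_le_if_add_le:
  fixes a b p q :: int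
  assumes "a * p + b * q \<le> p * q + 1" and "0 \<le> a" "0 \<le> b" "0 \<le> p" "0 \<le> q" and "1 < p * q"
  shows "4 * (a * b) \<le> p * q + 2"
proof (rule ccontr)
  assume "\<not> ?thesis"
  then have "(p * q + 3) * (p * q) \<le> 4 * (a * b) * (p * q)"
    using assms(6) by (intro mult_right_mono) auto
  also have "\<dots> = (a * p + b * q)\<^sup>2 - (a * p - b * q)\<^sup>2"
    by (simp add: power2_eq_square algebra_simps)
  also have "\<dots> \<le> (a * p + b * q)\<^sup>2"
    by simp
  also have "\<dots> \<le> (p * q + 1)\<^sup>2"
    using assms(1-5) by (intro power_mono) auto
  finally show False
    using assms(6) by (simp add: power2_eq_square algebra_simps)
qed

text \<open>The bound is the value of \<open>4 * b * (p * q + 1 - b * q)\<close> at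
  \<open>b = (p + 1) / 2\<close>, an integer since \<open>p\<close> is odd.\<close>

lemma four_mult_le_if_add_le_odd:
  fixes a b p q :: int
  assumes "a * p + b * q \<le> p * q + 1" and "0 \<le> b" "0 < q" and "odd p"
  shows "4 * (a * b) * p \<le> (p + 1) * (p * q + 1 - q + 1)"
proof -
  define d where "d = 2 * b - p"
  have "odd d"
    using \<open>odd p\<close> by (simp add: d_def)
  \<comment> \<open>This is the gap between the bound and the quadratic. Its roots in
    \<open>d\<close> are \<open>1\<close> and \<open>2 / q - 1\<close>, the latter above
    \<open>-1\<close>, so no odd integer lies strictly between them.\<close>
  have "0 \<le> (d - 1) * (q * (d + 1) - 2)"
  proof (cases "d \<le> 0")
    case True
    then have "d \<le> - 1"
      using \<open>odd d\<close> by (cases "d = 0") auto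
    then have "q * (d + 1) \<le> 0"
      using \<open>0 < q\<close> by (simp add: mult_nonneg_nonpos)
    then show ?thesis
      using True by (intro mult_nonpos_nonpos) auto
  next
    case False
    then have "1 * 2 \<le> q * (d + 1)"
      using \<open>0 < q\<close> by (intro mult_mono) auto
    then show ?thesis
      using False by simp
  qed
  also have "\<dots> = (p + 1) * (p * q + 1 - q + 1) - 4 * b * (p * q + 1 - b * q)"
    by (simp add: d_def algebra_simps)
  finally have "4 * b * (p * q + 1 - b * q) \<le> (p + 1) * (p * q + 1 - q + 1)"
    by simp
  moreover have "4 * b * (a * p) \<le> 4 * b * (p * q + 1 - b * q)"
    using assms(1,2) by (intro mult_left_mono) auto
  moreover have "4 * (a * b) * p = 4 * b * (a * p)"
    by simp
  ultimately show ?thesis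
    by linarith
qed

theorem theorem1p22:
  fixes G :: "('a, 'b) monoid_scheme"
    and n n1 n2 s t lam lam1 lam2 :: nat
  assumes "group G"
    and "finite (carrier G)"
    and "order G = n"
    and "n1 > 0" and "n2 > 0"
    and "n - 1 = n1 * n2"
    and "\<exists>S T. st_near_factorization G s t lam S T"
    and "min s t > 1"
    and "s = lam1 * n1" and "t = lam2 * n2"
    and "lam = lam1 * lam2"
  shows "real lam \<le>
    (if even n1 \<and> even n2 then (real n + 1) / 4
     else if odd n1 \<and> even n2 then
       (real n1 + 1) * (real n - real n2 + 1) / (4 * real n1)
     else if even n1 \<and> odd n2 then
       (real n2 + 1) * (real n - real n1 + 1) / (4 * real n2)
     else
       min ((real n1 + 1) * (real n - real n2 + 1) / (4 * real n1))
           ((real n2 + 1) * (real n - real n1 + 1) / (4 * real n2)))"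
proof -
  obtain S T where "st_near_factorization G s t lam S T"
    using assms(7) by blast
  then have "s + t \<le> n"
    using st_near_factorization_add_le_order assms(1-3) by metis
  \<comment> \<open>Both \<open>s\<close> and \<open>t\<close> exceed 1, so \<open>n\<close> is at
    least 4 and the truncated subtraction \<open>n - 1\<close> is exact.\<close>
  then have n: "n = n1 * n2 + 1" and "1 < n1 * n2"
    using assms(6,8) by auto
  have add_le: "int lam1 * int n1 + int lam2 * int n2 \<le> int n1 * int n2 + 1"
    using \<open>s + t \<le> n\<close> unfolding n assms(9,10) by (simp flip: of_nat_mult)
  have general: "real lam \<le> (real n + 1) / 4"
  proof -
    have "4 * (int lam1 * int lam2) \<le> int n1 * int n2 + 2"
      using \<open>1 < n1 * n2\<close> by (intro four_mult_le_if_add_le[OF add_le]) (simp_all flip: of_nat_mult)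
    then have "real_of_int (4 * (int lam1 * int lam2)) \<le> real_of_int (int n1 * int n2 + 2)"
      by (simp only: of_int_le_iff)
    then show ?thesis
      unfolding n assms(11) by simp
  qed
  have odd1: "real lam \<le> (real n1 + 1) * (real n - real n2 + 1) / (4 * real n1)" if "odd n1"
  proof -
    have "4 * (int lam1 * int lam2) * int n1 \<le> (int n1 + 1) * (int n1 * int n2 + 1 - int n2 + 1)"
      using that assms(5) by (intro four_mult_le_if_add_le_odd[OF add_le]) auto
    then have "real_of_int (4 * (int lam1 * int lam2) * int n1)
        \<le> real_of_int ((int n1 + 1) * (int n1 * int n2 + 1 - int n2 + 1))"
      by (simp only: of_int_le_iff)
    then show ?thesis
      unfolding n assms(11) using assms(4) by (simp add: pos_le_divide_eq mult_ac add_ac)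
  qed
  have odd2: "real lam \<le> (real n2 + 1) * (real n - real n1 + 1) / (4 * real n2)" if "odd n2"
  proof -
    \<comment> \<open>The numerical constraint is symmetric in the two factors, so the odd case
      applies with the roles exchanged.\<close>
    have "int lam2 * int n2 + int lam1 * int n1 \<le> int n2 * int n1 + 1"
      using add_le by (simp add: mult.commute add.commute)
    then have "4 * (int lam2 * int lam1) * int n2 \<le> (int n2 + 1) * (int n2 * int n1 + 1 - int n1 + 1)"
      using that assms(4) by (intro four_mult_le_if_add_le_odd) auto
    then have "real_of_int (4 * (int lam2 * int lam1) * int n2)
        \<le> real_of_int ((int n2 + 1) * (int n2 * int n1 + 1 - int n1 + 1))"
      by (simp only: of_int_le_iff)
    then show ?thesis
      unfolding n assms(11) using assms(5) by (simp add: pos_le_divide_eq mult_ac add_ac)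
  qed
  show ?thesis
    using general odd1 odd2 by simp
qed

end
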